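(* Let $P$ be a finite poset with greatest element $m$. If $\mathcal R$ is an admissible system for $P$ (over a $K$-algebra $A$), then $\Lambda=\Lambda(\mathcal R)$ is a right peak algebra.
   Context: Let $K$ be a field, $A$ a $K$-algebra and $(P,\le)$ a finite poset with greatest element $m$. A $P$-multiplicative system is a family $\mathcal R=\{\mathcal R_{i,j}\subseteq A\mid i\le j \text{ in } P\}$ of $K$-vector subspaces of $A$ such that (M.1) $\mathcal R_{i,j}\mathcal R_{j,l}\subseteq\mathcal R_{i,l}$ for $i\le j\le l$; (M.2) each $\mathcal R_i=\mathcal R_{i,i}$ is a $K$-algebra with unit $1_i$ such that $1_ir=r=r1_j$ for all $r\in\mathcal R_{i,j}$, $i\le j$. A $P$-multiplicative system $\mathcal R$ is an admissible system if moreover (A.1) each $\mathcal R_i$ is a division $K$-ring; (A.2) if $j<m$ and $0\ne x\in\mathcal R_{i,j}$, then there exists $y\in\mathcal R_{j,l}$, with $l\ne j$, such that $xy\neq0$. $\Lambda(\mathcal R)=\bigoplus_{i\le j}e_{i,j}\mathcal R_{i,j}$, where the $e_{i,j}$ are the standard matrix units indexed by $P$, with matrix addition and multiplication; it is a $K$-algebra with unit $\sum_{i\in P} e_{i,i}1_i$. An algebra is called right peak if its (right) socle is a direct sum of finite copies of a simple projective (right) module.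
   Formalization: Finitely many copies is claimed only if each R_{i,m} is finite-dimensional as a right R_m-space; otherwise it fails (P={1<m}, R_1=R_m=K, R_{1,m}=K(t)=A). In general the right socle is shown to be a direct sum of possibly infinitely many copies of one simple projective. *)

theory Defs
  imports "HOL-Algebra.Generated_Groups" "HOL-Algebra.Ring" HOL.Vector_Spaces
begin

section \<open>Right modules over a (not necessarily commutative) ring\<close>

text \<open>
  The library's modules are left modules over commutative rings. As there, the fields
  \<open>mult\<close> and \<open>one\<close> that a module record inherits from the ring record carry no meaning.
\<close>

record ('r, 'm) right_module = "'m ring" +
  ract :: "'m \<Rightarrow> 'r \<Rightarrow> 'm" (infixl "\<star>\<index>" 70)

locale right_module = R?: ring R + M?: abelian_group M
  for R :: "('r, 'c) ring_scheme" (structure)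
    and M :: "('r, 'm, 'd) right_module_scheme" (structure) +
  assumes ract_closed:
      "\<lbrakk>x \<in> carrier M; a \<in> carrier R\<rbrakk> \<Longrightarrow> x \<star>\<^bsub>M\<^esub> a \<in> carrier M"
    and ract_add_left:
      "\<lbrakk>x \<in> carrier M; y \<in> carrier M; a \<in> carrier R\<rbrakk> \<Longrightarrow>
        (x \<oplus>\<^bsub>M\<^esub> y) \<star>\<^bsub>M\<^esub> a = (x \<star>\<^bsub>M\<^esub> a) \<oplus>\<^bsub>M\<^esub> (y \<star>\<^bsub>M\<^esub> a)"
    and ract_add_right:
      "\<lbrakk>x \<in> carrier M; a \<in> carrier R; b \<in> carrier R\<rbrakk> \<Longrightarrow>
        x \<star>\<^bsub>M\<^esub> (a \<oplus>\<^bsub>R\<^esub> b) = (x \<star>\<^bsub>M\<^esub> a) \<oplus>\<^bsub>M\<^esub> (x \<star>\<^bsub>M\<^esub> b)"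
    and ract_assoc:
      "\<lbrakk>x \<in> carrier M; a \<in> carrier R; b \<in> carrier R\<rbrakk> \<Longrightarrow>
        x \<star>\<^bsub>M\<^esub> (a \<otimes>\<^bsub>R\<^esub> b) = (x \<star>\<^bsub>M\<^esub> a) \<star>\<^bsub>M\<^esub> b"
    and ract_one: "x \<in> carrier M \<Longrightarrow> x \<star>\<^bsub>M\<^esub> \<one>\<^bsub>R\<^esub> = x"

definition regular_right_module :: "('r, 'c) ring_scheme \<Rightarrow> ('r, 'r) right_module" where
  "regular_right_module R =
    \<lparr>carrier = carrier R, mult = mult R, one = one R, zero = zero R, add = add R, ract = mult R\<rparr>"

definition right_submodule ::
    "('r, 'c) ring_scheme \<Rightarrow> ('r, 'm, 'd) right_module_scheme \<Rightarrow> 'm set \<Rightarrow> bool" where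
  "right_submodule R M N \<longleftrightarrow>
    subgroup N (add_monoid M) \<and> (\<forall>x\<in>N. \<forall>a\<in>carrier R. x \<star>\<^bsub>M\<^esub> a \<in> N)"

definition simple_right_module ::
    "('r, 'c) ring_scheme \<Rightarrow> ('r, 'm, 'd) right_module_scheme \<Rightarrow> bool" where
  "simple_right_module R S \<longleftrightarrow>
    right_module R S \<and> carrier S \<noteq> {\<zero>\<^bsub>S\<^esub>} \<and>
    (\<forall>N. right_submodule R S N \<longrightarrow> N = {\<zero>\<^bsub>S\<^esub>} \<or> N = carrier S)"

text \<open>The sum of all simple submodules; a sum of submodules is the additive group they generate.\<close>

definition socle ::
    "('r, 'c) ring_scheme \<Rightarrow> ('r, 'm, 'd) right_module_scheme \<Rightarrow> 'm set" where
  "socle R M = generate (add_monoid M)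
    (\<Union>{N. right_submodule R M N \<and> simple_right_module R (M\<lparr>carrier := N\<rparr>)})"

definition right_socle_module :: "('r, 'c) ring_scheme \<Rightarrow> ('r, 'r) right_module" where
  "right_socle_module R =
    (regular_right_module R)\<lparr>carrier := socle R (regular_right_module R)\<rparr>"

definition right_module_hom ::
    "('r, 'c) ring_scheme \<Rightarrow> ('r, 'm, 'd) right_module_scheme \<Rightarrow>
     ('r, 'n, 'e) right_module_scheme \<Rightarrow> ('m \<Rightarrow> 'n) set" where
  "right_module_hom R M N = {f \<in> carrier M \<rightarrow> carrier N.
    (\<forall>x\<in>carrier M. \<forall>y\<in>carrier M. f (x \<oplus>\<^bsub>M\<^esub> y) = f x \<oplus>\<^bsub>N\<^esub> f y) \<and>
    (\<forall>x\<in>carrier M. \<forall>a\<in>carrier R. f (x \<star>\<^bsub>M\<^esub> a) = f x \<star>\<^bsub>N\<^esub> a)}"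

definition right_module_iso ::
    "('r, 'c) ring_scheme \<Rightarrow> ('r, 'm, 'd) right_module_scheme \<Rightarrow>
     ('r, 'n, 'e) right_module_scheme \<Rightarrow> bool" where
  "right_module_iso R M N \<longleftrightarrow> (\<exists>f\<in>right_module_hom R M N. bij_betw f (carrier M) (carrier N))"

text \<open>The direct sum of copies of \<open>S\<close> indexed by the set \<open>I\<close>.\<close>

definition copies_sum ::
    "'i set \<Rightarrow> ('r, 'm, 'd) right_module_scheme \<Rightarrow> ('r, 'i \<Rightarrow> 'm) right_module" where
  "copies_sum I S =
    \<lparr>carrier = {f \<in> I \<rightarrow>\<^sub>E carrier S. finite {i \<in> I. f i \<noteq> \<zero>\<^bsub>S\<^esub>}},
     mult = undefined, one = undefined,
     zero = (\<lambda>i\<in>I. \<zero>\<^bsub>S\<^esub>),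
     add = (\<lambda>f g. \<lambda>i\<in>I. f i \<oplus>\<^bsub>S\<^esub> g i),
     ract = (\<lambda>f a. \<lambda>i\<in>I. f i \<star>\<^bsub>S\<^esub> a)\<rparr>"

text \<open>
  Projectivity as the lifting property against surjections \<open>M \<rightarrow> N\<close>. A definition cannot quantify
  over types, so the carriers of \<open>M\<close> and \<open>N\<close> live in fixed types; these are large enough for
  the free module on the elements of \<open>P\<close> and for \<open>P\<close> itself, so the lifting property
  holds for all carrier types (lemma \<open>projective_right_module_lift\<close> below).
\<close>

definition projective_right_module ::
    "('r, 'c) ring_scheme \<Rightarrow> ('r, 'm) right_module \<Rightarrow> bool" where
  "projective_right_module R P \<longleftrightarrow> right_module R P \<and>
    (\<forall>(M :: ('r, 'm \<Rightarrow> 'r) right_module) (N :: ('r, 'm) right_module).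
      \<forall>g\<in>right_module_hom R M N. \<forall>f\<in>right_module_hom R P N.
        right_module R M \<longrightarrow> right_module R N \<longrightarrow> g ` carrier M = carrier N \<longrightarrow>
        (\<exists>h\<in>right_module_hom R P M. \<forall>x\<in>carrier P. g (h x) = f x))"

text \<open>
  The carrier of \<open>S\<close> and the index set \<open>I\<close> live in the type of the ring elements. This loses
  nothing: a simple module is a quotient of the regular one, and a direct sum of copies of \<open>S\<close>
  that embeds into the ring has at most as many summands as the ring has elements.
\<close>

definition right_peak :: "('r, 'c) ring_scheme \<Rightarrow> bool" where
  "right_peak R \<longleftrightarrow> ring R \<and>
    (\<exists>(S :: ('r, 'r) right_module) (I :: 'r set).
      simple_right_module R S \<and> projective_right_module R S \<and> finite I \<and> I \<noteq> {} \<and>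
      right_module_iso R (right_socle_module R) (copies_sum I S))"


section \<open>Multiplicative and admissible systems\<close>

locale algebra_over_field = vector_space scale
  for scale :: "'k::field \<Rightarrow> 'a::ring \<Rightarrow> 'a" +
  assumes scale_mult_left: "scale c x * y = scale c (x * y)"
    and scale_mult_right: "x * scale c y = scale c (x * y)"

text \<open>
  \<open>A\<close> is the type \<open>'a\<close>, not required to have a unit; \<open>u i\<close> is the unit of \<open>\<R> i i\<close>, which is
  determined by \<open>\<R>\<close>. Only the values \<open>\<R> i j\<close> with \<open>i \<le> j\<close> are relevant.
\<close>

locale multiplicative_system = algebra_over_field scale
  for scale :: "'k::field \<Rightarrow> 'a::ring \<Rightarrow> 'a" +
  fixes \<R> :: "'p::{finite,order} \<Rightarrow> 'p \<Rightarrow> 'a set" and u :: "'p \<Rightarrow> 'a"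
  assumes subspace_R: "i \<le> j \<Longrightarrow> subspace (\<R> i j)"
    and mult_R: "\<lbrakk>i \<le> j; j \<le> l; x \<in> \<R> i j; y \<in> \<R> j l\<rbrakk> \<Longrightarrow> x * y \<in> \<R> i l"
    and unit_in: "u i \<in> \<R> i i"
    and unit_left: "\<lbrakk>i \<le> j; r \<in> \<R> i j\<rbrakk> \<Longrightarrow> u i * r = r"
    and unit_right: "\<lbrakk>i \<le> j; r \<in> \<R> i j\<rbrakk> \<Longrightarrow> r * u j = r"

locale admissible_system = multiplicative_system scale \<R> u
  for scale :: "'k::field \<Rightarrow> 'a::ring \<Rightarrow> 'a"
    and \<R> :: "'p::{finite,order} \<Rightarrow> 'p \<Rightarrow> 'a set" and u :: "'p \<Rightarrow> 'a" +
  fixes m :: 'p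
  assumes greatest: "i \<le> m"
    and unit_nonzero: "u i \<noteq> 0"
    and division: "\<lbrakk>x \<in> \<R> i i; x \<noteq> 0\<rbrakk> \<Longrightarrow> \<exists>y\<in>\<R> i i. x * y = u i \<and> y * x = u i"
    and nondegenerate:
      "\<lbrakk>i \<le> j; j < m; x \<in> \<R> i j; x \<noteq> 0\<rbrakk> \<Longrightarrow> \<exists>l y. j \<le> l \<and> l \<noteq> j \<and> y \<in> \<R> j l \<and> x * y \<noteq> 0"

definition Lambda ::
    "('p::{finite,order} \<Rightarrow> 'p \<Rightarrow> 'a::ring set) \<Rightarrow> ('p \<Rightarrow> 'a) \<Rightarrow> ('p \<Rightarrow> 'p \<Rightarrow> 'a) ring" where
  "Lambda \<R> u =
    \<lparr>carrier = {X. \<forall>i j. (i \<le> j \<longrightarrow> X i j \<in> \<R> i j) \<and> (\<not> i \<le> j \<longrightarrow> X i j = 0)},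
     mult = (\<lambda>X Y i j. \<Sum>l\<in>UNIV. X i l * Y l j),
     one = (\<lambda>i j. if i = j then u i else 0),
     zero = (\<lambda>i j. 0),
     add = (\<lambda>X Y i j. X i j + Y i j)\<rparr>"

text \<open>
  \<open>V\<close> is spanned by finitely many of its elements as a right vector space over \<open>D\<close>. For an
  admissible system and \<open>V = \<R> i m\<close>, \<open>D = \<R> m m\<close> this is automatic when \<open>A\<close> is
  finite-dimensional, but not in general: for \<open>P = {i < m}\<close>, \<open>A = K(t)\<close>, \<open>\<R> i i = \<R> m m = K\<close>
  and \<open>\<R> i m = K(t)\<close>, the right socle of \<open>\<Lambda>(\<R>)\<close> has infinite length.
\<close>

definition finite_right_span :: "'a::ring set \<Rightarrow> 'a set \<Rightarrow> bool" where
  "finite_right_span V D \<longleftrightarrow>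
    (\<exists>B\<subseteq>V. finite B \<and> (\<forall>v\<in>V. \<exists>c. (\<forall>b\<in>B. c b \<in> D) \<and> v = (\<Sum>b\<in>B. b * c b)))"


section \<open>Consistency checks\<close>

lemma (in multiplicative_system) ring_Lambda: "ring (Lambda \<R> u)"
proof -
  have z: "0 \<in> \<R> i j" if "i \<le> j" for i j using subspace_0[OF subspace_R[OF that]] .
  have ad: "x + y \<in> \<R> i j" if "i \<le> j" "x \<in> \<R> i j" "y \<in> \<R> i j" for i j x y
    using subspace_add[OF subspace_R[OF that(1)] that(2,3)] .
  have ng: "- x \<in> \<R> i j" if "i \<le> j" "x \<in> \<R> i j" for i j x
    using subspace_neg[OF subspace_R[OF that(1)] that(2)] .
  have sm: "(\<Sum>l\<in>UNIV. X i l * Y l j) \<in> \<R> i j"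
    if X: "X \<in> carrier (Lambda \<R> u)" and Y: "Y \<in> carrier (Lambda \<R> u)" and "i \<le> j" for X Y i j
  proof (rule subspace_sum[OF subspace_R[OF \<open>i \<le> j\<close>]])
    fix l
    show "X i l * Y l j \<in> \<R> i j"
      using X Y z[OF \<open>i \<le> j\<close>] mult_R[of i l j]
      by (cases "i \<le> l"; cases "l \<le> j") (auto simp: Lambda_def)
  qed
  have sz: "(\<Sum>l\<in>UNIV. X i l * Y l j) = 0"
    if X: "X \<in> carrier (Lambda \<R> u)" and Y: "Y \<in> carrier (Lambda \<R> u)" and "\<not> i \<le> j" for X Y i j
  proof (rule sum.neutral, rule ballI)
    fix l
    show "X i l * Y l j = 0"
      using X Y \<open>\<not> i \<le> j\<close> order_trans[of i l j]
      by (cases "i \<le> l"; cases "l \<le> j") (auto simp: Lambda_def)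
  qed
  have as: "(\<Sum>l\<in>UNIV. (\<Sum>k\<in>UNIV. X i k * Y k l) * Z l j) =
      (\<Sum>k\<in>UNIV. X i k * (\<Sum>l\<in>UNIV. Y k l * Z l j))" for X Y Z :: "'p \<Rightarrow> 'p \<Rightarrow> 'a" and i j
    unfolding sum_distrib_left sum_distrib_right
    by (subst sum.swap) (simp add: mult.assoc)
  have ol: "(\<Sum>l\<in>UNIV. (if i = l then u i else 0) * X l j) = X i j"
    if "X \<in> carrier (Lambda \<R> u)" for X i j
  proof -
    have "(\<Sum>l\<in>UNIV. (if i = l then u i else 0) * X l j) = (\<Sum>l\<in>UNIV. if i = l then u i * X l j else 0)"
      by (rule sum.cong) auto
    also have "\<dots> = u i * X i j" by simp
    also have "\<dots> = X i j"
      using that unit_left[of i j] by (cases "i \<le> j") (auto simp: Lambda_def)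
    finally show ?thesis .
  qed
  have orr: "(\<Sum>l\<in>UNIV. X i l * (if l = j then u l else 0)) = X i j"
    if "X \<in> carrier (Lambda \<R> u)" for X i j
  proof -
    have "(\<Sum>l\<in>UNIV. X i l * (if l = j then u l else 0)) = (\<Sum>l\<in>UNIV. if j = l then X i l * u l else 0)"
      by (rule sum.cong) auto
    also have "\<dots> = X i j * u j" by simp
    also have "\<dots> = X i j"
      using that unit_right[of i j] by (cases "i \<le> j") (auto simp: Lambda_def)
    finally show ?thesis .
  qed
  show ?thesis
  proof (rule ringI)
    show "abelian_group (Lambda \<R> u)"
    proof (rule abelian_groupI)
      fix X assume X: "X \<in> carrier (Lambda \<R> u)"
      show "\<exists>Y\<in>carrier (Lambda \<R> u). Y \<oplus>\<^bsub>Lambda \<R> u\<^esub> X = \<zero>\<^bsub>Lambda \<R> u\<^esub>"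
        by (rule bexI[of _ "\<lambda>i j. - X i j"]) (use X ng in \<open>auto simp: Lambda_def\<close>)
    qed (auto simp: Lambda_def z ad algebra_simps)
    show "monoid (Lambda \<R> u)"
    proof (rule monoidI)
      fix X Y assume XY: "X \<in> carrier (Lambda \<R> u)" "Y \<in> carrier (Lambda \<R> u)"
      show "X \<otimes>\<^bsub>Lambda \<R> u\<^esub> Y \<in> carrier (Lambda \<R> u)"
        using sm[OF XY] sz[OF XY] by (simp add: Lambda_def)
    next
      show "\<one>\<^bsub>Lambda \<R> u\<^esub> \<in> carrier (Lambda \<R> u)"
        using z unit_in by (auto simp: Lambda_def)
    next
      fix X assume "X \<in> carrier (Lambda \<R> u)"
      from ol[OF this] show "\<one>\<^bsub>Lambda \<R> u\<^esub> \<otimes>\<^bsub>Lambda \<R> u\<^esub> X = X" by (simp add: Lambda_def)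
    next
      fix X assume "X \<in> carrier (Lambda \<R> u)"
      from orr[OF this] show "X \<otimes>\<^bsub>Lambda \<R> u\<^esub> \<one>\<^bsub>Lambda \<R> u\<^esub> = X" by (simp add: Lambda_def)
    qed (auto simp: Lambda_def as)
  qed (auto simp: Lambda_def distrib_left distrib_right sum.distrib)
qed

context right_module
begin

lemma ract_zero_right: "x \<in> carrier M \<Longrightarrow> x \<star>\<^bsub>M\<^esub> \<zero>\<^bsub>R\<^esub> = \<zero>\<^bsub>M\<^esub>"
  using ract_add_right[of x "\<zero>\<^bsub>R\<^esub>" "\<zero>\<^bsub>R\<^esub>"] ract_closed[of x "\<zero>\<^bsub>R\<^esub>"]
  by (metis M.add.l_cancel_one' R.add.one_closed R.add.r_one)

lemma ract_zero_left: "a \<in> carrier R \<Longrightarrow> \<zero>\<^bsub>M\<^esub> \<star>\<^bsub>M\<^esub> a = \<zero>\<^bsub>M\<^esub>"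
  using ract_add_left[of "\<zero>\<^bsub>M\<^esub>" "\<zero>\<^bsub>M\<^esub>" a] ract_closed[of "\<zero>\<^bsub>M\<^esub>" a]
  by (metis M.add.l_cancel_one' M.add.one_closed M.add.r_one)

lemma ract_finsum:
  assumes "finite A" "w \<in> A \<rightarrow> carrier M" "a \<in> carrier R"
  shows "finsum M w A \<star>\<^bsub>M\<^esub> a = finsum M (\<lambda>x. w x \<star>\<^bsub>M\<^esub> a) A"
  using assms
proof (induction A rule: finite_induct)
  case empty
  then show ?case by (simp add: ract_zero_left)
next
  case (insert x A)
  then show ?case
    by (simp add: Pi_iff ract_closed ract_add_left M.finsum_closed)
qed

end

lemma hom_finsum:
  assumes "right_module R M" "right_module R N" "g \<in> right_module_hom R M N"
    "finite A" "w \<in> A \<rightarrow> carrier M"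
  shows "g (finsum M w A) = finsum N (\<lambda>x. g (w x)) A"
proof -
  interpret M: right_module R M by fact
  interpret N: right_module R N by fact
  have g: "\<And>x. x \<in> carrier M \<Longrightarrow> g x \<in> carrier N"
    "\<And>x y. \<lbrakk>x \<in> carrier M; y \<in> carrier M\<rbrakk> \<Longrightarrow> g (x \<oplus>\<^bsub>M\<^esub> y) = g x \<oplus>\<^bsub>N\<^esub> g y"
    using assms(3) by (auto simp: right_module_hom_def)
  have g0: "g \<zero>\<^bsub>M\<^esub> = \<zero>\<^bsub>N\<^esub>"
    using g(1)[of "\<zero>\<^bsub>M\<^esub>"] g(2)[of "\<zero>\<^bsub>M\<^esub>" "\<zero>\<^bsub>M\<^esub>"]
    by (metis M.M.add.one_closed M.M.add.r_one N.M.add.l_cancel_one')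
  show ?thesis using assms(4,5)
  proof (induction A rule: finite_induct)
    case empty
    then show ?case by (simp add: g0)
  next
    case (insert x A)
    then show ?case by (simp add: Pi_iff g M.M.finsum_closed)
  qed
qed

lemma right_module_regular:
  assumes "ring R" shows "right_module R (regular_right_module R)"
proof -
  interpret ring R by fact
  show ?thesis
  proof (intro right_module.intro right_module_axioms.intro assms abelian_groupI)
    fix x assume "x \<in> carrier (regular_right_module R)"
    then show "\<exists>y\<in>carrier (regular_right_module R).
      y \<oplus>\<^bsub>regular_right_module R\<^esub> x = \<zero>\<^bsub>regular_right_module R\<^esub>"
      by (auto simp: regular_right_module_def intro: bexI[of _ "\<ominus>\<^bsub>R\<^esub> x"] l_neg)
  qed (auto simp: regular_right_module_def a_ac l_distr r_distr m_assoc)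
qed

lemma right_module_copies_sum:
  assumes "right_module R S" shows "right_module R (copies_sum I S)"
proof -
  interpret right_module R S by fact
  show ?thesis
  proof (intro right_module.intro right_module_axioms.intro abelian_groupI)
    show "ring R" by (rule R.ring_axioms)
  next
    fix f g assume fg: "f \<in> carrier (copies_sum I S)" "g \<in> carrier (copies_sum I S)"
    have "finite {i \<in> I. f i \<oplus>\<^bsub>S\<^esub> g i \<noteq> \<zero>\<^bsub>S\<^esub>}"
      by (rule finite_subset[of _ "{i \<in> I. f i \<noteq> \<zero>\<^bsub>S\<^esub>} \<union> {i \<in> I. g i \<noteq> \<zero>\<^bsub>S\<^esub>}"])
        (use fg in \<open>auto simp: copies_sum_def\<close>)
    then show "f \<oplus>\<^bsub>copies_sum I S\<^esub> g \<in> carrier (copies_sum I S)"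
      using fg by (auto simp: copies_sum_def PiE_iff cong: conj_cong)
  next
    show "\<zero>\<^bsub>copies_sum I S\<^esub> \<in> carrier (copies_sum I S)"
      by (auto simp: copies_sum_def cong: conj_cong)
  next
    fix f assume f: "f \<in> carrier (copies_sum I S)"
    have "finite {i \<in> I. \<ominus>\<^bsub>S\<^esub> f i \<noteq> \<zero>\<^bsub>S\<^esub>}"
      by (rule finite_subset[of _ "{i \<in> I. f i \<noteq> \<zero>\<^bsub>S\<^esub>}"]) (use f in \<open>auto simp: copies_sum_def\<close>)
    then show "\<exists>g\<in>carrier (copies_sum I S). g \<oplus>\<^bsub>copies_sum I S\<^esub> f = \<zero>\<^bsub>copies_sum I S\<^esub>"
      using f by (intro bexI[of _ "\<lambda>i\<in>I. \<ominus>\<^bsub>S\<^esub> f i"])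
        (auto simp: copies_sum_def PiE_iff M.l_neg fun_eq_iff extensional_def cong: conj_cong)
    show "\<zero>\<^bsub>copies_sum I S\<^esub> \<oplus>\<^bsub>copies_sum I S\<^esub> f = f"
      using f by (auto simp: copies_sum_def PiE_iff fun_eq_iff extensional_def)
    show "f \<star>\<^bsub>copies_sum I S\<^esub> \<one>\<^bsub>R\<^esub> = f"
      using f by (auto simp: copies_sum_def PiE_iff fun_eq_iff extensional_def ract_one)
  next
    fix f a assume fa: "f \<in> carrier (copies_sum I S)" "a \<in> carrier R"
    have "finite {i \<in> I. f i \<star>\<^bsub>S\<^esub> a \<noteq> \<zero>\<^bsub>S\<^esub>}"
      by (rule finite_subset[of _ "{i \<in> I. f i \<noteq> \<zero>\<^bsub>S\<^esub>}"])
        (use fa in \<open>auto simp: copies_sum_def ract_zero_left\<close>)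
    then show "f \<star>\<^bsub>copies_sum I S\<^esub> a \<in> carrier (copies_sum I S)"
      using fa by (auto simp: copies_sum_def PiE_iff ract_closed cong: conj_cong)
  qed (auto simp: copies_sum_def PiE_iff fun_eq_iff M.a_ac ract_add_left ract_add_right ract_assoc)
qed

lemma free_module_hom:
  assumes "right_module R M" "w \<in> I \<rightarrow> carrier M"
  defines "F \<equiv> copies_sum I (regular_right_module R)"
  shows "(\<lambda>\<phi>. finsum M (\<lambda>i. w i \<star>\<^bsub>M\<^esub> \<phi> i) {i \<in> I. \<phi> i \<noteq> \<zero>\<^bsub>R\<^esub>}) \<in> right_module_hom R F M"
    (is "?k \<in> _")
proof -
  interpret right_module R M by fact
  have F: "\<phi> i \<in> carrier R" "finite {i \<in> I. \<phi> i \<noteq> \<zero>\<^bsub>R\<^esub>}" if "\<phi> \<in> carrier F" "i \<in> I" for \<phi> i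
    using that by (auto simp: F_def copies_sum_def regular_right_module_def PiE_iff)
  have Ff: "finite {i \<in> I. \<phi> i \<noteq> \<zero>\<^bsub>R\<^esub>}" if "\<phi> \<in> carrier F" for \<phi>
    using that by (auto simp: F_def copies_sum_def regular_right_module_def)
  have w: "w i \<in> carrier M" if "i \<in> I" for i using assms(2) that by auto
  have ext: "?k \<phi> = finsum M (\<lambda>i. w i \<star>\<^bsub>M\<^esub> \<phi> i) B"
    if "\<phi> \<in> carrier F" "finite B" "B \<subseteq> I" "{i \<in> I. \<phi> i \<noteq> \<zero>\<^bsub>R\<^esub>} \<subseteq> B" for \<phi> B
    using that by (intro M.add.finprod_mono_neutral_cong_left)
      (auto intro!: ract_closed w F simp: ract_zero_right w subset_iff)
  show ?thesis unfolding right_module_hom_def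
  proof (intro CollectI conjI ballI)
    show "?k \<in> carrier F \<rightarrow> carrier M"
      by (auto intro!: M.finsum_closed ract_closed w F)
  next
    fix \<phi> \<psi> assume p: "\<phi> \<in> carrier F" "\<psi> \<in> carrier F"
    let ?B = "{i \<in> I. \<phi> i \<noteq> \<zero>\<^bsub>R\<^esub>} \<union> {i \<in> I. \<psi> i \<noteq> \<zero>\<^bsub>R\<^esub>}"
    have s: "\<phi> \<oplus>\<^bsub>F\<^esub> \<psi> \<in> carrier F"
      using right_module_copies_sum[OF right_module_regular[OF R.ring_axioms], of I] p
      unfolding F_def by (meson abelian_groupE(1) right_module.axioms(2))
    have c: "(\<phi> \<oplus>\<^bsub>F\<^esub> \<psi>) i = \<phi> i \<oplus>\<^bsub>R\<^esub> \<psi> i" if "i \<in> I" for i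
      using that by (simp add: F_def copies_sum_def regular_right_module_def)
    have fB: "finite ?B" using Ff p by blast
    have "?k (\<phi> \<oplus>\<^bsub>F\<^esub> \<psi>) = finsum M (\<lambda>i. w i \<star>\<^bsub>M\<^esub> (\<phi> \<oplus>\<^bsub>F\<^esub> \<psi>) i) ?B"
      by (rule ext[OF s fB]) (auto simp: c)
    also have "\<dots> = finsum M (\<lambda>i. w i \<star>\<^bsub>M\<^esub> \<phi> i \<oplus>\<^bsub>M\<^esub> w i \<star>\<^bsub>M\<^esub> \<psi> i) ?B"
      by (rule M.finsum_cong') (auto simp: c ract_add_right w F p intro!: ract_closed M.a_closed)
    also have "\<dots> = finsum M (\<lambda>i. w i \<star>\<^bsub>M\<^esub> \<phi> i) ?B \<oplus>\<^bsub>M\<^esub> finsum M (\<lambda>i. w i \<star>\<^bsub>M\<^esub> \<psi> i) ?B"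
      by (rule M.finsum_addf) (auto intro!: ract_closed w F p)
    also have "\<dots> = ?k \<phi> \<oplus>\<^bsub>M\<^esub> ?k \<psi>"
      using ext[OF p(1) fB] ext[OF p(2) fB] by auto
    finally show "?k (\<phi> \<oplus>\<^bsub>F\<^esub> \<psi>) = ?k \<phi> \<oplus>\<^bsub>M\<^esub> ?k \<psi>" .
  next
    fix \<phi> a assume p: "\<phi> \<in> carrier F" "a \<in> carrier R"
    let ?B = "{i \<in> I. \<phi> i \<noteq> \<zero>\<^bsub>R\<^esub>}"
    have s: "\<phi> \<star>\<^bsub>F\<^esub> a \<in> carrier F"
      using right_module.ract_closed[OF right_module_copies_sum[OF right_module_regular[OF R.ring_axioms]]] p
      unfolding F_def by blast
    have c: "(\<phi> \<star>\<^bsub>F\<^esub> a) i = \<phi> i \<otimes>\<^bsub>R\<^esub> a" if "i \<in> I" for i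
      using that by (simp add: F_def copies_sum_def regular_right_module_def)
    have "?k (\<phi> \<star>\<^bsub>F\<^esub> a) = finsum M (\<lambda>i. w i \<star>\<^bsub>M\<^esub> (\<phi> \<star>\<^bsub>F\<^esub> a) i) ?B"
      by (rule ext[OF s Ff[OF p(1)]]) (auto simp: c p)
    also have "\<dots> = finsum M (\<lambda>i. (w i \<star>\<^bsub>M\<^esub> \<phi> i) \<star>\<^bsub>M\<^esub> a) ?B"
      by (rule M.finsum_cong') (auto simp: c ract_assoc w F p intro!: ract_closed)
    also have "\<dots> = ?k \<phi> \<star>\<^bsub>M\<^esub> a"
      by (rule ract_finsum[symmetric]) (auto intro!: ract_closed w F p Ff)
    finally show "?k (\<phi> \<star>\<^bsub>F\<^esub> a) = ?k \<phi> \<star>\<^bsub>M\<^esub> a" .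
  qed
qed

lemma projective_right_module_lift:
  fixes R :: "('r, 'c) ring_scheme" and P :: "('r, 'm) right_module"
    and M :: "('r, 'x, 'd) right_module_scheme" and N :: "('r, 'y, 'e) right_module_scheme"
  assumes P: "projective_right_module R P" and M: "right_module R M" and N: "right_module R N"
    and g: "g \<in> right_module_hom R M N" and surj: "g ` carrier M = carrier N"
    and f: "f \<in> right_module_hom R P N"
  shows "\<exists>h\<in>right_module_hom R P M. \<forall>x\<in>carrier P. g (h x) = f x"
proof -
  have P': "right_module R P" using P by (simp add: projective_right_module_def)
  interpret P: right_module R P by fact
  interpret M: right_module R M by fact
  interpret N: right_module R N by fact
  define F where "F = copies_sum (carrier P) (regular_right_module R)"
  have F: "right_module R F"
    unfolding F_def by (intro right_module_copies_sum right_module_regular P.R.ring_axioms)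
  have FC: "\<phi> \<in> carrier F \<longleftrightarrow> \<phi> \<in> carrier P \<rightarrow>\<^sub>E carrier R \<and> finite {x \<in> carrier P. \<phi> x \<noteq> \<zero>\<^bsub>R\<^esub>}" for \<phi>
    by (simp add: F_def copies_sum_def regular_right_module_def)
  define p where "p = (\<lambda>\<phi>. finsum P (\<lambda>x. x \<star>\<^bsub>P\<^esub> \<phi> x) {x \<in> carrier P. \<phi> x \<noteq> \<zero>\<^bsub>R\<^esub>})"
  have p: "p \<in> right_module_hom R F P"
    unfolding p_def F_def by (rule free_module_hom[OF P', of "\<lambda>x. x"]) auto
  have "y \<in> p ` carrier F" if y: "y \<in> carrier P" for y
  proof (cases "\<one>\<^bsub>R\<^esub> = \<zero>\<^bsub>R\<^esub>")
    case True
    then have "y = \<zero>\<^bsub>P\<^esub>" using P.ract_one[OF y] P.ract_zero_right[OF y] by simp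
    moreover have "p (\<lambda>x\<in>carrier P. \<zero>\<^bsub>R\<^esub>) = \<zero>\<^bsub>P\<^esub>"
      by (simp add: p_def cong: conj_cong)
    ultimately show ?thesis
      by (intro image_eqI[of _ _ "\<lambda>x\<in>carrier P. \<zero>\<^bsub>R\<^esub>"]) (auto simp: FC cong: conj_cong)
  next
    case False
    let ?d = "\<lambda>x\<in>carrier P. if x = y then \<one>\<^bsub>R\<^esub> else \<zero>\<^bsub>R\<^esub>"
    have s: "{x \<in> carrier P. ?d x \<noteq> \<zero>\<^bsub>R\<^esub>} = {y}" using y False by auto
    then have "?d \<in> carrier F" by (simp add: FC)
    moreover have "p ?d = y" unfolding p_def s using y by (simp add: P.ract_one)
    ultimately show ?thesis by (metis imageI)
  qed
  then have "p ` carrier F = carrier P" using p by (auto simp: right_module_hom_def)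
  moreover have "(\<lambda>x. x) \<in> right_module_hom R P P" by (auto simp: right_module_hom_def)
  ultimately obtain s where s: "s \<in> right_module_hom R P F" "\<And>x. x \<in> carrier P \<Longrightarrow> p (s x) = x"
    using P p F P' unfolding projective_right_module_def by metis
  have fc: "f x \<in> carrier N" if "x \<in> carrier P" for x
    using f that by (auto simp: right_module_hom_def)
  then have "\<forall>x\<in>carrier P. \<exists>z\<in>carrier M. g z = f x" using surj by (metis imageE)
  then obtain w where w: "\<And>x. x \<in> carrier P \<Longrightarrow> w x \<in> carrier M" "\<And>x. x \<in> carrier P \<Longrightarrow> g (w x) = f x"
    by metis
  define k where "k = (\<lambda>\<phi>. finsum M (\<lambda>x. w x \<star>\<^bsub>M\<^esub> \<phi> x) {x \<in> carrier P. \<phi> x \<noteq> \<zero>\<^bsub>R\<^esub>})"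
  have k: "k \<in> right_module_hom R F M"
    unfolding k_def F_def by (rule free_module_hom[OF M]) (use w in auto)
  have gk: "g (k \<phi>) = f (p \<phi>)" if \<phi>: "\<phi> \<in> carrier F" for \<phi>
  proof -
    let ?B = "{x \<in> carrier P. \<phi> x \<noteq> \<zero>\<^bsub>R\<^esub>}"
    have B: "finite ?B" "\<And>x. x \<in> carrier P \<Longrightarrow> \<phi> x \<in> carrier R" using \<phi> by (auto simp: FC)
    have "g (k \<phi>) = finsum N (\<lambda>x. g (w x \<star>\<^bsub>M\<^esub> \<phi> x)) ?B"
      unfolding k_def by (rule hom_finsum[OF M N g B(1)]) (auto intro!: M.ract_closed w B)
    also have "\<dots> = finsum N (\<lambda>x. f (x \<star>\<^bsub>P\<^esub> \<phi> x)) ?B"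
      by (rule N.M.finsum_cong')
        (use f g w B in \<open>auto simp: right_module_hom_def intro!: fc N.ract_closed P.ract_closed\<close>)
    also have "\<dots> = f (p \<phi>)"
      unfolding p_def by (rule hom_finsum[OF P' N f B(1), symmetric]) (auto intro!: P.ract_closed B)
    finally show ?thesis .
  qed
  show ?thesis
  proof (intro bexI[of _ "\<lambda>x. k (s x)"] ballI)
    show "(\<lambda>x. k (s x)) \<in> right_module_hom R P M"
      using k s(1) by (auto simp: right_module_hom_def Pi_iff)
    show "g (k (s x)) = f x" if "x \<in> carrier P" for x
      using gk[of "s x"] s that by (auto simp: right_module_hom_def Pi_iff)
  qed
qed

end

theory Submission
  imports Defs
begin

text \<open>
  Iterating (A.2), every nonzero \<open>x \<in> \<R> i j\<close> has a nonzero product with some \<open>y \<in> \<R> j m\<close>, so every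
  nonzero right ideal of \<open>\<Lambda>(\<R>)\<close> meets the right ideal \<open>V\<close> of matrices supported in the column
  \<open>m\<close>. With \<open>e\<close> the idempotent of the corner \<open>(m, m)\<close>, \<open>\<Lambda>(\<R>)\<close> acts on \<open>V\<close> through the division
  ring \<open>D = \<R> m m\<close>, and every nonzero \<open>X \<in> V\<close> generates the simple module \<open>X D\<close>; hence \<open>V\<close> is the
  socle. A basis of \<open>V\<close> over \<open>D\<close> splits it into copies of \<open>e \<Lambda>(\<R>)\<close>, which is projective since \<open>e\<close>
  is idempotent.
\<close>

section \<open>Modules over a ring with a division idempotent\<close>

text \<open>Closure under negation comes for free: the negative of \<open>x\<close> is
  \<open>x\<close> acted on by the negative of the ring's unit. This leaves four conditions that are
  easy to check.\<close>

lemma (in right_module) right_submodule_iff: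
  "right_submodule R M N \<longleftrightarrow> N \<subseteq> carrier M \<and> \<zero>\<^bsub>M\<^esub> \<in> N \<and>
    (\<forall>x\<in>N. \<forall>y\<in>N. x \<oplus>\<^bsub>M\<^esub> y \<in> N) \<and> (\<forall>x\<in>N. \<forall>a\<in>carrier R. x \<star>\<^bsub>M\<^esub> a \<in> N)"
proof -
  have neg: "\<ominus>\<^bsub>M\<^esub> x = x \<star>\<^bsub>M\<^esub> (\<ominus>\<^bsub>R\<^esub> \<one>\<^bsub>R\<^esub>)" if "x \<in> carrier M" for x
  proof (rule M.minus_equality)
    have "x \<star>\<^bsub>M\<^esub> (\<ominus>\<^bsub>R\<^esub> \<one>\<^bsub>R\<^esub>) \<oplus>\<^bsub>M\<^esub> x \<star>\<^bsub>M\<^esub> \<one>\<^bsub>R\<^esub> = x \<star>\<^bsub>M\<^esub> (\<ominus>\<^bsub>R\<^esub> \<one>\<^bsub>R\<^esub> \<oplus>\<^bsub>R\<^esub> \<one>\<^bsub>R\<^esub>)"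
      using that by (simp add: ract_add_right)
    then show "x \<star>\<^bsub>M\<^esub> (\<ominus>\<^bsub>R\<^esub> \<one>\<^bsub>R\<^esub>) \<oplus>\<^bsub>M\<^esub> x = \<zero>\<^bsub>M\<^esub>"
      using that by (simp add: ract_one R.l_neg ract_zero_right)
  qed (use that in \<open>auto intro: ract_closed\<close>)
  show ?thesis
  proof
    assume "right_submodule R M N"
    then show "N \<subseteq> carrier M \<and> \<zero>\<^bsub>M\<^esub> \<in> N \<and>
      (\<forall>x\<in>N. \<forall>y\<in>N. x \<oplus>\<^bsub>M\<^esub> y \<in> N) \<and> (\<forall>x\<in>N. \<forall>a\<in>carrier R. x \<star>\<^bsub>M\<^esub> a \<in> N)"
      using subgroup.one_closed subgroup.m_closed subgroup.subset
      unfolding right_submodule_def by fastforce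
  next
    assume N: "N \<subseteq> carrier M \<and> \<zero>\<^bsub>M\<^esub> \<in> N \<and>
      (\<forall>x\<in>N. \<forall>y\<in>N. x \<oplus>\<^bsub>M\<^esub> y \<in> N) \<and> (\<forall>x\<in>N. \<forall>a\<in>carrier R. x \<star>\<^bsub>M\<^esub> a \<in> N)"
    moreover have "inv\<^bsub>add_monoid M\<^esub> x \<in> N" if "x \<in> N" for x
      using N neg[of x] that R.add.inv_closed[OF R.one_closed] unfolding a_inv_def[of M, symmetric]
      by auto
    ultimately show "right_submodule R M N"
      unfolding right_submodule_def by (auto intro!: M.add.subgroupI simp: a_inv_def)
  qed
qed

lemma right_module_restrict:
  assumes "right_module R M" "right_submodule R M N"
  shows "right_module R (M\<lparr>carrier := N\<rparr>)"
proof -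
  interpret right_module R M by fact
  have N: "N \<subseteq> carrier M" "\<zero>\<^bsub>M\<^esub> \<in> N" "\<And>x y. \<lbrakk>x \<in> N; y \<in> N\<rbrakk> \<Longrightarrow> x \<oplus>\<^bsub>M\<^esub> y \<in> N"
    "\<And>x a. \<lbrakk>x \<in> N; a \<in> carrier R\<rbrakk> \<Longrightarrow> x \<star>\<^bsub>M\<^esub> a \<in> N"
    using assms(2) unfolding right_submodule_iff by auto
  have sub: "x \<in> carrier M" if "x \<in> N" for x using that N(1) by auto
  have inv: "\<ominus>\<^bsub>M\<^esub> x \<in> N" if "x \<in> N" for x
    using assms(2) that subgroup.m_inv_closed unfolding right_submodule_def a_inv_def by fast
  show ?thesis
  proof (intro right_module.intro right_module_axioms.intro abelian_groupI)
    show "\<exists>y\<in>carrier (M\<lparr>carrier := N\<rparr>). y \<oplus>\<^bsub>M\<lparr>carrier := N\<rparr>\<^esub> x = \<zero>\<^bsub>M\<lparr>carrier := N\<rparr>\<^esub>"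
      if "x \<in> carrier (M\<lparr>carrier := N\<rparr>)" for x
      using that inv[of x] sub[of x] by (auto intro!: bexI[of _ "\<ominus>\<^bsub>M\<^esub> x"] M.l_neg)
  qed (use N(2-4) sub in \<open>auto simp: M.a_ac ract_add_left ract_add_right ract_assoc ract_one R.ring_axioms\<close>)
qed

lemma right_submodule_restrict_iff:
  assumes "right_module R M" "right_submodule R M N"
  shows "right_submodule R (M\<lparr>carrier := N\<rparr>) L \<longleftrightarrow> right_submodule R M L \<and> L \<subseteq> N"
proof -
  interpret right_module R M by fact
  interpret N: right_module R "M\<lparr>carrier := N\<rparr>" by (rule right_module_restrict[OF assms])
  show ?thesis
    using assms(2) unfolding N.right_submodule_iff right_submodule_iff by auto
qed

lemma right_submodule_hom_image:
  assumes "right_module R M" "right_module R N" "f \<in> right_module_hom R M N"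
  shows "right_submodule R N (f ` carrier M)"
proof -
  interpret M: right_module R M by fact
  interpret N: right_module R N by fact
  have f: "\<And>x. x \<in> carrier M \<Longrightarrow> f x \<in> carrier N"
    "\<And>x y. \<lbrakk>x \<in> carrier M; y \<in> carrier M\<rbrakk> \<Longrightarrow> f x \<oplus>\<^bsub>N\<^esub> f y = f (x \<oplus>\<^bsub>M\<^esub> y)"
    "\<And>x a. \<lbrakk>x \<in> carrier M; a \<in> carrier R\<rbrakk> \<Longrightarrow> f x \<star>\<^bsub>N\<^esub> a = f (x \<star>\<^bsub>M\<^esub> a)"
    using assms(3) by (auto simp: right_module_hom_def)
  \<comment> \<open>The empty case of \<open>hom_finsum\<close> says that \<open>f\<close> preserves
    zero.\<close>
  have "f \<zero>\<^bsub>M\<^esub> = \<zero>\<^bsub>N\<^esub>"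
    using hom_finsum[OF assms, of "{}"] by simp
  then have "\<zero>\<^bsub>N\<^esub> \<in> f ` carrier M" by (metis M.M.zero_closed imageI)
  then show ?thesis
    unfolding N.right_submodule_iff by (auto simp: f M.ract_closed)
qed

lemma right_module_iso_sym:
  assumes "right_module R M" "right_module_iso R M N"
  shows "right_module_iso R N M"
proof -
  interpret right_module R M by fact
  obtain f where f: "f \<in> right_module_hom R M N" "bij_betw f (carrier M) (carrier N)"
    using assms(2) unfolding right_module_iso_def by auto
  let ?g = "inv_into (carrier M) f"
  have g: "?g y \<in> carrier M" "f (?g y) = y" if "y \<in> carrier N" for y
    using f(2) that by (auto simp: bij_betw_def inv_into_into f_inv_into_f)
  \<comment> \<open>Reduces the homomorphism equations for \<open>?g\<close> to those for
    \<open>f\<close>.\<close>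
  have eq: "?g y = x" if "x \<in> carrier M" "f x = y" for x y
    using f(2) that by (auto simp: bij_betw_def inv_into_f_f)
  have "?g \<in> right_module_hom R N M"
    unfolding right_module_hom_def
    by (intro CollectI conjI ballI)
      (use f(1) in \<open>auto simp: g right_module_hom_def ract_closed intro!: eq\<close>)
  then show ?thesis
    unfolding right_module_iso_def using bij_betw_inv_into[OF f(2)] by blast
qed

section \<open>Simple modules, projective right ideals and bases\<close>

text \<open>A nonzero submodule of \<open>x S\<close> contains some \<open>x s\<close> with
  \<open>s\<close> nonzero. Choosing \<open>t\<close> with \<open>s t = e\<close> gives
  \<open>x s t = x e = x\<close>, so the submodule contains \<open>x\<close> and hence all of
  \<open>x S\<close>. The lemma serves both for the simplicity of \<open>S\<close> itself (take
  \<open>x = e\<close>) and for the simple submodules that make up the socle.\<close>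

lemma simple_right_module_ract_image:
  assumes "right_module R M" and S: "right_submodule R (regular_right_module R) S" and "e \<in> S"
    and inv: "\<And>s. \<lbrakk>s \<in> S; s \<noteq> \<zero>\<^bsub>R\<^esub>\<rbrakk> \<Longrightarrow> \<exists>t\<in>carrier R. s \<otimes>\<^bsub>R\<^esub> t = e"
    and x: "x \<in> carrier M" "x \<noteq> \<zero>\<^bsub>M\<^esub>" "x \<star>\<^bsub>M\<^esub> e = x"
  shows "right_submodule R M ((\<lambda>s. x \<star>\<^bsub>M\<^esub> s) ` S)"
    and "simple_right_module R (M\<lparr>carrier := (\<lambda>s. x \<star>\<^bsub>M\<^esub> s) ` S\<rparr>)"
proof -
  interpret right_module R M by fact
  interpret reg: right_module R "regular_right_module R"
    by (rule right_module_regular[OF R.ring_axioms])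
  have SR: "S \<subseteq> carrier R" "\<zero>\<^bsub>R\<^esub> \<in> S" "\<And>s t. \<lbrakk>s \<in> S; t \<in> S\<rbrakk> \<Longrightarrow> s \<oplus>\<^bsub>R\<^esub> t \<in> S"
    "\<And>s a. \<lbrakk>s \<in> S; a \<in> carrier R\<rbrakk> \<Longrightarrow> s \<otimes>\<^bsub>R\<^esub> a \<in> S"
    using S unfolding reg.right_submodule_iff by (auto simp: regular_right_module_def)
  let ?X = "(\<lambda>s. x \<star>\<^bsub>M\<^esub> s) ` S"
  have car: "s \<in> carrier R" if "s \<in> S" for s using that SR(1) by auto
  have "\<zero>\<^bsub>M\<^esub> \<in> ?X" using SR(2) x(1) by (auto simp: ract_zero_right intro!: image_eqI[of _ _ "\<zero>\<^bsub>R\<^esub>"])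
  then show sub: "right_submodule R M ?X"
    unfolding right_submodule_iff
    by (auto simp: x(1) car SR ract_closed ract_add_right[symmetric] ract_assoc[symmetric])
  have "x \<in> ?X" using x(3) \<open>e \<in> S\<close> by (metis imageI)
  show "simple_right_module R (M\<lparr>carrier := ?X\<rparr>)"
    unfolding simple_right_module_def
  proof (intro conjI allI impI)
    show "right_module R (M\<lparr>carrier := ?X\<rparr>)" by (rule right_module_restrict[OF assms(1) sub])
    show "carrier (M\<lparr>carrier := ?X\<rparr>) \<noteq> {\<zero>\<^bsub>M\<lparr>carrier := ?X\<rparr>\<^esub>}"
      using \<open>x \<in> ?X\<close> x(2) by auto
  next
    fix L assume "right_submodule R (M\<lparr>carrier := ?X\<rparr>) L"
    then have L: "right_submodule R M L" "L \<subseteq> ?X"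
      by (auto simp: right_submodule_restrict_iff[OF assms(1) sub])
    show "L = {\<zero>\<^bsub>M\<lparr>carrier := ?X\<rparr>\<^esub>} \<or> L = carrier (M\<lparr>carrier := ?X\<rparr>)"
    proof (cases "L \<subseteq> {\<zero>\<^bsub>M\<^esub>}")
      case True
      then show ?thesis using L(1) unfolding right_submodule_iff by auto
    next
      case False
      then obtain s where s: "s \<in> S" "x \<star>\<^bsub>M\<^esub> s \<in> L" "x \<star>\<^bsub>M\<^esub> s \<noteq> \<zero>\<^bsub>M\<^esub>" using L(2) by auto
      then have "s \<noteq> \<zero>\<^bsub>R\<^esub>" using x(1) by (auto simp: ract_zero_right)
      then obtain t where t: "t \<in> carrier R" "s \<otimes>\<^bsub>R\<^esub> t = e" using inv s(1) by blast
      have "x = (x \<star>\<^bsub>M\<^esub> s) \<star>\<^bsub>M\<^esub> t"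
        using x t s car by (simp add: ract_assoc[symmetric])
      then have "x \<in> L" using L(1) s(2) t(1) unfolding right_submodule_iff by metis
      then have "?X \<subseteq> L" using L(1) car unfolding right_submodule_iff by auto
      then show ?thesis using L(2) by auto
    qed
  qed
qed

text \<open>Since \<open>e\<close> is a left identity on \<open>S\<close>, a homomorphism from
  \<open>S\<close> is determined by its value at \<open>e\<close>. If \<open>z\<close> is a preimage
  of \<open>f e\<close> under \<open>g\<close>, then \<open>s\<close> mapping to \<open>z s\<close>
  is a lift of \<open>f\<close>, because \<open>g (z s) = (f e) s = f (e s) = f s\<close>.\<close>

lemma projective_right_ideal:
  assumes "ring R" and S: "right_submodule R (regular_right_module R) S"
    and e: "e \<in> S" "\<And>s. s \<in> S \<Longrightarrow> e \<otimes>\<^bsub>R\<^esub> s = s"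
  shows "projective_right_module R ((regular_right_module R)\<lparr>carrier := S\<rparr>)"
  unfolding projective_right_module_def
proof (intro conjI allI ballI impI)
  let ?S = "(regular_right_module R)\<lparr>carrier := S\<rparr>"
  show "right_module R ?S"
    by (rule right_module_restrict[OF right_module_regular[OF \<open>ring R\<close>] S])
  fix M :: "('a, 'a \<Rightarrow> 'a) right_module" and N :: "('a, 'a) right_module" and g f
  assume g: "g \<in> right_module_hom R M N" and f: "f \<in> right_module_hom R ?S N"
    and M: "right_module R M" and N: "right_module R N" and surj: "g ` carrier M = carrier N"
  interpret M: right_module R M by fact
  interpret reg: right_module R "regular_right_module R"
    by (rule right_module_regular[OF \<open>ring R\<close>])
  have SR: "s \<in> carrier R" if "s \<in> S" for s
    using S that unfolding reg.right_submodule_iff by (auto simp: regular_right_module_def)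
  have "f e \<in> carrier N" using f e(1) by (auto simp: right_module_hom_def)
  then obtain z where z: "z \<in> carrier M" "g z = f e" using surj by (metis imageE)
  have "(\<lambda>s. z \<star>\<^bsub>M\<^esub> s) \<in> right_module_hom R ?S M"
    using z SR by (auto simp: right_module_hom_def regular_right_module_def M.ract_closed
        M.ract_add_right M.ract_assoc)
  moreover have "g (z \<star>\<^bsub>M\<^esub> s) = f s" if "s \<in> S" for s
  proof -
    have "g (z \<star>\<^bsub>M\<^esub> s) = f e \<star>\<^bsub>N\<^esub> s" using g z SR[OF that] by (simp add: right_module_hom_def)
    also have "\<dots> = f (e \<otimes>\<^bsub>R\<^esub> s)"
      using f e(1) SR[OF that] by (simp add: right_module_hom_def regular_right_module_def)
    finally show ?thesis using e(2)[OF that] by simp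
  qed
  ultimately show "\<exists>h\<in>right_module_hom R ?S M. \<forall>x\<in>carrier ?S. g (h x) = f x" by auto
qed

text \<open>
  A maximal independent subset \<open>I\<close> of \<open>G\<close> serves as a basis, so \<open>I\<close> is finite if \<open>G\<close> is.
\<close>

lemma right_module_iso_copies_sum:
  fixes R :: "('r, 'c) ring_scheme" and M :: "('r, 'm, 'd) right_module_scheme"
  assumes M: "right_module R M"
    and S: "right_submodule R (regular_right_module R) S" and e: "e \<in> S"
    and inv: "\<And>s. \<lbrakk>s \<in> S; s \<noteq> \<zero>\<^bsub>R\<^esub>\<rbrakk> \<Longrightarrow> \<exists>t\<in>carrier R. s \<otimes>\<^bsub>R\<^esub> t = e"
    and Me: "\<And>x. x \<in> carrier M \<Longrightarrow> x \<star>\<^bsub>M\<^esub> e = x"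
    and G: "G \<subseteq> carrier M" "\<And>N. \<lbrakk>right_submodule R M N; G \<subseteq> N\<rbrakk> \<Longrightarrow> N = carrier M"
  shows "\<exists>I\<subseteq>G. right_module_iso R M (copies_sum I ((regular_right_module R)\<lparr>carrier := S\<rparr>))"
proof -
  interpret right_module R M by fact
  interpret reg: right_module R "regular_right_module R"
    by (rule right_module_regular[OF R.ring_axioms])
  have SR: "s \<in> carrier R" if "s \<in> S" for s
    using S that unfolding reg.right_submodule_iff by (auto simp: regular_right_module_def)
  have S0: "\<zero>\<^bsub>R\<^esub> \<in> S"
    using S unfolding reg.right_submodule_iff by (auto simp: regular_right_module_def)
  let ?S = "(regular_right_module R)\<lparr>carrier := S\<rparr>"
  \<comment> \<open>Coefficients range over \<open>S\<close>, the module that is being copied, so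
    that independence of \<open>I\<close> is what makes the map \<phi> below injective.\<close>
  define indep where "indep B \<longleftrightarrow> (\<forall>A c. finite A \<longrightarrow> A \<subseteq> B \<longrightarrow> c \<in> A \<rightarrow> S \<longrightarrow>
    finsum M (\<lambda>b. b \<star>\<^bsub>M\<^esub> c b) A = \<zero>\<^bsub>M\<^esub> \<longrightarrow> (\<forall>b\<in>A. c b = \<zero>\<^bsub>R\<^esub>))" for B
  have "\<exists>I\<in>{B. B \<subseteq> G \<and> indep B}. \<forall>B\<in>{B. B \<subseteq> G \<and> indep B}. I \<subseteq> B \<longrightarrow> B = I"
  proof (rule subset_Zorn)
    fix C assume C: "subset.chain {B. B \<subseteq> G \<and> indep B} C"
    have "indep (\<Union>C)"
      unfolding indep_def
    proof (intro allI impI)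
      fix A c assume A: "finite A" "A \<subseteq> \<Union>C" "c \<in> A \<rightarrow> S"
        "finsum M (\<lambda>b. b \<star>\<^bsub>M\<^esub> c b) A = \<zero>\<^bsub>M\<^esub>"
      show "\<forall>b\<in>A. c b = \<zero>\<^bsub>R\<^esub>"
      \<comment> \<open>A finite subset of the union lies in one member of a chain only if the chain
        is nonempty; an empty \<open>A\<close> is therefore treated apart.\<close>
      proof (cases "A = {}")
        case False
        then have "C \<noteq> {}" using A(2) by auto
        then obtain B where "B \<in> C" "A \<subseteq> B"
          using finite_subset_Union_chain[OF A(1,2) _ C] by blast
        then show ?thesis using C A unfolding subset.chain_def indep_def by blast
      qed simp
    qed
    then have "\<Union>C \<in> {B. B \<subseteq> G \<and> indep B}" using C unfolding subset.chain_def by auto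
    then show "\<exists>U\<in>{B. B \<subseteq> G \<and> indep B}. \<forall>X\<in>C. X \<subseteq> U" by blast
  qed
  then obtain I where "I \<in> {B. B \<subseteq> G \<and> indep B}"
    and max: "\<forall>B\<in>{B. B \<subseteq> G \<and> indep B}. I \<subseteq> B \<longrightarrow> B = I"
    by (rule bexE)
  then have I: "I \<subseteq> G" "indep I" by auto
  have max: "B = I" if "B \<subseteq> G" "indep B" "I \<subseteq> B" for B
    using max that by simp
  have IM: "b \<in> carrier M" if "b \<in> I" for b using that I(1) G(1) by auto
  have C: "right_module R (copies_sum I ?S)"
    by (intro right_module_copies_sum right_module_restrict right_module_regular R.ring_axioms S)
  interpret C: right_module R "copies_sum I ?S" by fact
  have Ccar: "f \<in> carrier (copies_sum I ?S) \<longleftrightarrow> f \<in> I \<rightarrow>\<^sub>E S \<and> finite {b \<in> I. f b \<noteq> \<zero>\<^bsub>R\<^esub>}" for f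
    by (simp add: copies_sum_def regular_right_module_def)
  \<comment> \<open>The linear combination map; \<open>I\<close> may be infinite, so the sum runs
    over the finite support of \<open>f\<close>.\<close>
  define \<phi> where "\<phi> f = finsum M (\<lambda>b. b \<star>\<^bsub>M\<^esub> f b) {b \<in> I. f b \<noteq> \<zero>\<^bsub>R\<^esub>}" for f
  have "\<phi> \<in> right_module_hom R (copies_sum I (regular_right_module R)) M"
    unfolding \<phi>_def by (rule free_module_hom[OF M]) (use IM in auto)
  then have \<phi>: "\<phi> \<in> right_module_hom R (copies_sum I ?S) M"
    using SR by (auto simp: right_module_hom_def copies_sum_def regular_right_module_def PiE_iff Pi_iff)
  let ?Im = "\<phi> ` carrier (copies_sum I ?S)"
  have Im: "right_submodule R M ?Im" by (rule right_submodule_hom_image[OF C M \<phi>])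
  have sum_Im: "finsum M (\<lambda>b. b \<star>\<^bsub>M\<^esub> c b) A \<in> ?Im" if A: "finite A" "A \<subseteq> I" "c \<in> A \<rightarrow> S" for A c
  proof (rule image_eqI)
    \<comment> \<open>The extension of \<open>c\<close> by zero may have a support smaller than
      \<open>A\<close>; terms with coefficient zero do not change the sum.\<close>
    let ?f = "\<lambda>b\<in>I. if b \<in> A then c b else \<zero>\<^bsub>R\<^esub>"
    have supp: "{b \<in> I. ?f b \<noteq> \<zero>\<^bsub>R\<^esub>} \<subseteq> A" by auto
    show "finsum M (\<lambda>b. b \<star>\<^bsub>M\<^esub> c b) A = \<phi> ?f"
      unfolding \<phi>_def
      by (rule M.add.finprod_mono_neutral_cong_right)
        (use A IM SR in \<open>auto intro!: ract_closed simp: Pi_iff subset_iff ract_zero_right split: if_splits\<close>)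
    show "?f \<in> carrier (copies_sum I ?S)"
      unfolding Ccar using A S0 finite_subset[OF supp A(1)] by auto
  qed
  have "G \<subseteq> ?Im"
  proof
    fix v assume v: "v \<in> G"
    then have vM: "v \<in> carrier M" using G by auto
    show "v \<in> ?Im"
    proof (cases "v \<in> I")
      case True
      \<comment> \<open>A member of \<open>I\<close> is the one-term combination with coefficient
        \<open>e\<close>, by \<open>Me\<close>.\<close>
      then show ?thesis using sum_Im[of "{v}" "\<lambda>_. e"] e vM by (simp add: Me)
    next
      case False
      then have "\<not> indep (insert v I)" using I(1) max[of "insert v I"] v by auto
      then obtain A c b where A: "finite A" "A \<subseteq> insert v I" "c \<in> A \<rightarrow> S"
        "finsum M (\<lambda>b. b \<star>\<^bsub>M\<^esub> c b) A = \<zero>\<^bsub>M\<^esub>" "b \<in> A" "c b \<noteq> \<zero>\<^bsub>R\<^esub>"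
        unfolding indep_def by blast
      \<comment> \<open>A nontrivial relation inside \<open>I\<close> is excluded, so the relation
        given by maximality involves \<open>v\<close>.\<close>
      have "v \<in> A" using A I(2) unfolding indep_def by blast
      define B where "B = A - {v}"
      have B: "A = insert v B" "v \<notin> B" "finite B" "B \<subseteq> I" "c \<in> B \<rightarrow> S" "c v \<in> S"
        using A \<open>v \<in> A\<close> by (auto simp: B_def)
      define w where "w = finsum M (\<lambda>b. b \<star>\<^bsub>M\<^esub> c b) B"
      have wM: "w \<in> carrier M"
        unfolding w_def using B IM SR by (intro M.finsum_closed) (auto intro!: ract_closed)
      have sum0: "v \<star>\<^bsub>M\<^esub> c v \<oplus>\<^bsub>M\<^esub> w = \<zero>\<^bsub>M\<^esub>"
        using A(4) B IM SR vM unfolding B(1) w_def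
        by (subst (asm) M.finsum_insert) (auto intro!: ract_closed)
      \<comment> \<open>Otherwise the remaining terms form a relation inside \<open>I\<close>, and
        all coefficients vanish, including \<open>c b\<close>.\<close>
      have "c v \<noteq> \<zero>\<^bsub>R\<^esub>"
      proof
        assume cv: "c v = \<zero>\<^bsub>R\<^esub>"
        then have "w = \<zero>\<^bsub>M\<^esub>" using sum0 vM wM by (simp add: ract_zero_right)
        then have "\<forall>b\<in>B. c b = \<zero>\<^bsub>R\<^esub>" using I(2) B unfolding indep_def w_def by blast
        then show False using A(5,6) cv B(1) by auto
      qed
      then obtain t where t: "t \<in> carrier R" "c v \<otimes>\<^bsub>R\<^esub> t = e" using inv B(6) by blast
      \<comment> \<open>The relation is solved for \<open>v\<close>: acting with \<open>t\<close>
        turns the coefficient \<open>c v\<close> into \<open>e\<close>, which fixes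
        \<open>v\<close>, and turns the negative of \<open>w\<close> into another element of the
        image.\<close>
      have "v = (v \<star>\<^bsub>M\<^esub> c v) \<star>\<^bsub>M\<^esub> t"
        using t vM B(6) SR by (simp add: ract_assoc[symmetric] Me)
      moreover have "v \<star>\<^bsub>M\<^esub> c v = \<ominus>\<^bsub>M\<^esub> w"
        using sum0 wM vM B(6) SR by (intro M.minus_equality[symmetric]) (auto intro!: ract_closed)
      moreover have "\<ominus>\<^bsub>M\<^esub> w \<in> ?Im"
        using Im sum_Im[OF B(3-5)] subgroup.m_inv_closed
        unfolding w_def right_submodule_def a_inv_def by fast
      ultimately show ?thesis using Im t(1) unfolding right_submodule_def by metis
    qed
  qed
  then have surj: "?Im = carrier M" using G(2)[OF Im] by blast
  have "\<phi> \<in> hom (add_monoid (copies_sum I ?S)) (add_monoid M)"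
    using \<phi> unfolding right_module_hom_def hom_def by simp
  then have h: "group_hom (add_monoid (copies_sum I ?S)) (add_monoid M) \<phi>"
    by (intro group_hom.intro group_hom_axioms.intro C.M.a_group M.a_group)
  have "inj_on \<phi> (carrier (copies_sum I ?S))"
  proof -
    have "f = \<zero>\<^bsub>copies_sum I ?S\<^esub>" if f: "f \<in> carrier (copies_sum I ?S)" "\<phi> f = \<zero>\<^bsub>M\<^esub>" for f
    proof -
      have "f \<in> {b \<in> I. f b \<noteq> \<zero>\<^bsub>R\<^esub>} \<rightarrow> S" "finite {b \<in> I. f b \<noteq> \<zero>\<^bsub>R\<^esub>}"
        using f(1) unfolding Ccar by auto
      \<comment> \<open>Independence is applied to the support of \<open>f\<close>, where by
        definition no coefficient is zero; so the support is empty.\<close>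
      then have "\<forall>b\<in>{b \<in> I. f b \<noteq> \<zero>\<^bsub>R\<^esub>}. f b = \<zero>\<^bsub>R\<^esub>"
        using I(2)[unfolded indep_def, rule_format, of "{b \<in> I. f b \<noteq> \<zero>\<^bsub>R\<^esub>}" f] f(2)
        unfolding \<phi>_def by blast
      then have "f b = (\<lambda>b\<in>I. \<zero>\<^bsub>R\<^esub>) b" for b
        using f(1) unfolding Ccar by (cases "b \<in> I") (auto simp: PiE_iff extensional_def)
      then show ?thesis
        by (simp add: copies_sum_def regular_right_module_def fun_eq_iff)
    qed
    then show ?thesis using group_hom.inj_on_one_iff[OF h] by simp
  qed
  then have "right_module_iso R (copies_sum I ?S) M"
    unfolding right_module_iso_def bij_betw_def using \<phi> surj by blast
  then show ?thesis using right_module_iso_sym[OF C] I(1) by blast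
qed

section \<open>The right socle of \<open>\<Lambda>(\<R>)\<close>\<close>

definition matrix_entry :: "'p \<Rightarrow> 'p \<Rightarrow> 'a::zero \<Rightarrow> 'p \<Rightarrow> 'p \<Rightarrow> 'a" where
  "matrix_entry i j a = (\<lambda>k l. if k = i \<and> l = j then a else 0)"

text \<open>This product carries column \<open>k\<close> into column \<open>l\<close>. With
  \<open>l = m\<close> it moves a nonzero entry into the last column; with \<open>k = l = m\<close>
  it is the scalar action of \<open>\<R> m m\<close> on that column.\<close>

lemma Lambda_mult_matrix_entry:
  "X \<otimes>\<^bsub>Lambda \<R> u\<^esub> matrix_entry k l a = (\<lambda>i j. if j = l then X i k * a else 0)"
proof (intro ext)
  fix i j
  have "(\<Sum>h\<in>UNIV. X i h * matrix_entry k l a h j) =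
      (\<Sum>h\<in>UNIV. if h = k then (if j = l then X i k * a else 0) else 0)"
    by (rule sum.cong) (auto simp: matrix_entry_def)
  then show "(X \<otimes>\<^bsub>Lambda \<R> u\<^esub> matrix_entry k l a) i j = (if j = l then X i k * a else 0)"
    by (simp add: Lambda_def)
qed

section \<open>The last column and the corner as right ideals\<close>

context admissible_system
begin

abbreviation \<Lambda> where "\<Lambda> \<equiv> Lambda \<R> u"

definition last_column :: "('p \<Rightarrow> 'p \<Rightarrow> 'a) set" where
  "last_column = {X \<in> carrier \<Lambda>. \<forall>i j. j \<noteq> m \<longrightarrow> X i j = 0}"

text \<open>This is the right ideal \<open>e\<close> \<Lambda> for the idempotent
  \<open>e = matrix_entry m m (u m)\<close>: as \<open>m\<close> is the greatest element, the bottom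
  row of a matrix in \<Lambda> has only its diagonal entry. It is a copy of the division ring
  \<open>\<R> m m\<close>.\<close>

definition corner :: "('p \<Rightarrow> 'p \<Rightarrow> 'a) set" where
  "corner = {X \<in> last_column. \<forall>i j. i \<noteq> m \<longrightarrow> X i j = 0}"

sublocale regular: right_module \<Lambda> "regular_right_module \<Lambda>"
  by (rule right_module_regular[OF ring_Lambda])

lemma zero_in: "i \<le> j \<Longrightarrow> 0 \<in> \<R> i j"
  by (rule subspace_0[OF subspace_R])

lemma matrix_entry_in: "\<lbrakk>i \<le> j; a \<in> \<R> i j\<rbrakk> \<Longrightarrow> matrix_entry i j a \<in> carrier \<Lambda>"
  by (auto simp: Lambda_def matrix_entry_def zero_in)

lemma regular_simps:
  "carrier (regular_right_module \<Lambda>) = carrier \<Lambda>"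
  "\<zero>\<^bsub>regular_right_module \<Lambda>\<^esub> = (\<lambda>i j. 0)"
  "X \<oplus>\<^bsub>regular_right_module \<Lambda>\<^esub> Y = (\<lambda>i j. X i j + Y i j)"
  "X \<star>\<^bsub>regular_right_module \<Lambda>\<^esub> Y = X \<otimes>\<^bsub>\<Lambda>\<^esub> Y"
  by (simp_all add: regular_right_module_def Lambda_def)

lemma Lambda_carrier_ops:
  "(\<lambda>i j. 0) \<in> carrier \<Lambda>"
  "\<lbrakk>X \<in> carrier \<Lambda>; Y \<in> carrier \<Lambda>\<rbrakk> \<Longrightarrow> (\<lambda>i j. X i j + Y i j) \<in> carrier \<Lambda>"
  "\<lbrakk>X \<in> carrier \<Lambda>; Y \<in> carrier \<Lambda>\<rbrakk> \<Longrightarrow> X \<otimes>\<^bsub>\<Lambda>\<^esub> Y \<in> carrier \<Lambda>"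
  using regular.M.zero_closed regular.M.a_closed[of X Y] regular.ract_closed[of X Y]
  unfolding regular_simps by blast+

text \<open>Only the summand \<open>l = m\<close> survives, so a matrix acts on the last column
  through its bottom row. For a matrix in \<Lambda>, \<open>Lambda_bottom_row\<close> reduces this
  further to the single scalar \<open>Y m m\<close>.\<close>

lemma last_column_mult:
  assumes "X \<in> last_column"
  shows "X \<otimes>\<^bsub>\<Lambda>\<^esub> Y = (\<lambda>i j. X i m * Y m j)"
proof (intro ext)
  fix i j
  have "(\<Sum>l\<in>UNIV. X i l * Y l j) = (\<Sum>l\<in>UNIV. if l = m then X i m * Y m j else 0)"
    by (rule sum.cong) (use assms in \<open>auto simp: last_column_def\<close>)
  then show "(X \<otimes>\<^bsub>\<Lambda>\<^esub> Y) i j = X i m * Y m j" by (simp add: Lambda_def)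
qed

lemma Lambda_bottom_row: "\<lbrakk>Y \<in> carrier \<Lambda>; j \<noteq> m\<rbrakk> \<Longrightarrow> Y m j = 0"
  using greatest[of j] by (auto simp: Lambda_def)

text \<open>A product has entries \<open>X i m * Y m j\<close>, and these vanish for
  \<open>j \<noteq> m\<close> because the bottom row of \<open>Y\<close> does.\<close>

lemma right_submodule_last_column: "right_submodule \<Lambda> (regular_right_module \<Lambda>) last_column"
  unfolding regular.right_submodule_iff regular_simps
proof (intro conjI ballI)
  fix X Y assume "X \<in> last_column" "Y \<in> carrier \<Lambda>"
  then show "X \<otimes>\<^bsub>\<Lambda>\<^esub> Y \<in> last_column"
    unfolding last_column_mult[OF \<open>X \<in> last_column\<close>]
    using Lambda_carrier_ops(3)[of X Y] last_column_mult[OF \<open>X \<in> last_column\<close>]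
    by (auto simp: last_column_def Lambda_bottom_row)
qed (auto simp: last_column_def Lambda_carrier_ops)

lemma right_submodule_corner: "right_submodule \<Lambda> (regular_right_module \<Lambda>) corner"
  using right_submodule_last_column
  unfolding regular.right_submodule_iff regular_simps
  by (auto simp: corner_def last_column_mult)

lemma corner_unit_in: "matrix_entry m m (u m) \<in> corner"
  using matrix_entry_in[of m m "u m"] unit_in
  by (auto simp: corner_def last_column_def matrix_entry_def)

lemma corner_unit_nonzero: "matrix_entry m m (u m) \<noteq> (\<lambda>i j. 0)"
  using unit_nonzero by (auto simp: matrix_entry_def fun_eq_iff)

lemma corner_unit_left:
  assumes "X \<in> corner"
  shows "matrix_entry m m (u m) \<otimes>\<^bsub>\<Lambda>\<^esub> X = X"
proof (intro ext)
  fix i j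
  have X: "X k l = 0" if "k \<noteq> m \<or> l \<noteq> m" for k l
    using assms that by (auto simp: corner_def last_column_def)
  have "X m m \<in> \<R> m m" using assms by (simp add: corner_def last_column_def Lambda_def)
  then have "u m * X m m = X m m" by (rule unit_left[OF order_refl])
  then have "matrix_entry m m (u m) i m * X m j = X i j"
    using X by (cases "i = m"; cases "j = m") (simp_all add: matrix_entry_def)
  moreover have "matrix_entry m m (u m) \<in> last_column"
    using corner_unit_in by (simp add: corner_def)
  ultimately show "(matrix_entry m m (u m) \<otimes>\<^bsub>\<Lambda>\<^esub> X) i j = X i j"
    by (simp add: last_column_mult)
qed

lemma last_column_unit_right:
  assumes "X \<in> last_column"
  shows "X \<otimes>\<^bsub>\<Lambda>\<^esub> matrix_entry m m (u m) = X"
proof (intro ext)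
  fix i j
  have "X i m \<in> \<R> i m" using assms greatest by (simp add: last_column_def Lambda_def)
  then have "X i m * u m = X i m" by (rule unit_right[OF greatest])
  then show "(X \<otimes>\<^bsub>\<Lambda>\<^esub> matrix_entry m m (u m)) i j = X i j"
    unfolding Lambda_mult_matrix_entry using assms by (simp add: last_column_def)
qed

text \<open>The only possibly nonzero entry of \<open>X\<close> lies in the division ring
  \<open>\<R> m m\<close>, and its inverse placed at \<open>(m, m)\<close> serves as
  \<open>Y\<close>. This supplies the invertibility hypothesis of the general module lemmas.\<close>

lemma corner_inverse:
  assumes "X \<in> corner" "X \<noteq> (\<lambda>i j. 0)"
  shows "\<exists>Y\<in>carrier \<Lambda>. X \<otimes>\<^bsub>\<Lambda>\<^esub> Y = matrix_entry m m (u m)"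
proof -
  have "X i j = 0" if "i \<noteq> m \<or> j \<noteq> m" for i j
    using that assms(1) by (auto simp: corner_def last_column_def)
  moreover from this have "X m m \<noteq> 0" using assms(2) by (metis ext)
  moreover have "X m m \<in> \<R> m m" using assms(1) by (auto simp: corner_def last_column_def Lambda_def)
  ultimately obtain y where y: "y \<in> \<R> m m" "X m m * y = u m" "\<And>i j. i \<noteq> m \<or> j \<noteq> m \<Longrightarrow> X i j = 0"
    using division by blast
  then have "X \<otimes>\<^bsub>\<Lambda>\<^esub> matrix_entry m m y = matrix_entry m m (u m)"
    unfolding Lambda_mult_matrix_entry by (auto simp: matrix_entry_def fun_eq_iff)
  then show ?thesis using y(1) matrix_entry_in by blast
qed

lemma Lambda_zero: "\<zero>\<^bsub>\<Lambda>\<^esub> = (\<lambda>i j. 0)"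
  by (simp add: Lambda_def)

lemma simple_corner: "simple_right_module \<Lambda> ((regular_right_module \<Lambda>)\<lparr>carrier := corner\<rparr>)"
proof -
  \<comment> \<open>With \<open>x = e\<close> the module \<open>x S\<close> of
    \<open>simple_right_module_ract_image\<close> is the corner itself.\<close>
  have "(\<lambda>s. matrix_entry m m (u m) \<otimes>\<^bsub>\<Lambda>\<^esub> s) ` corner = corner"
    by (simp add: corner_unit_left)
  then show ?thesis
    using simple_right_module_ract_image(2)[OF regular.right_module_axioms right_submodule_corner
        corner_unit_in, of "matrix_entry m m (u m)"]
    using corner_unit_in corner_unit_nonzero corner_unit_left corner_inverse
    by (simp add: regular_simps Lambda_zero matrix_entry_in[OF order_refl unit_in])
qed

lemma projective_corner:
  "projective_right_module \<Lambda> ((regular_right_module \<Lambda>)\<lparr>carrier := corner\<rparr>)"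
  by (rule projective_right_ideal[OF ring_Lambda right_submodule_corner corner_unit_in corner_unit_left])

section \<open>Determination of the right socle\<close>

text \<open>Each use of \<open>nondegenerate\<close> moves the second index strictly up from
  \<open>j\<close> to some \<open>l\<close>, which shrinks the set of elements above it. The process
  stops at \<open>m\<close>, where \<open>u m\<close> is the required factor; the factors found on
  the way are multiplied together.\<close>

lemma nonzero_mult_greatest:
  "\<lbrakk>i \<le> j; x \<in> \<R> i j; x \<noteq> 0\<rbrakk> \<Longrightarrow> \<exists>y\<in>\<R> j m. x * y \<noteq> 0"
proof (induction "card {l. j < l}" arbitrary: j x rule: less_induct)
  case less
  show ?case
  proof (cases "j = m")
    case True
    then show ?thesis using less.prems(3) unit_right[OF less.prems(1,2)] unit_in[of j]
      by (auto intro!: bexI[of _ "u m"])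
  next
    case False
    then obtain l y where l: "j \<le> l" "l \<noteq> j" "y \<in> \<R> j l" "x * y \<noteq> 0"
      using nondegenerate[OF less.prems(1) _ less.prems(2,3)] greatest[of j] False
      by (auto simp: order.strict_iff_order)
    \<comment> \<open>The element \<open>l\<close> itself witnesses that the inclusion of the strict
      upper sets is proper.\<close>
    have "l \<in> {h. j < h}" "l \<notin> {h. l < h}" "{h. l < h} \<subseteq> {h. j < h}"
      using l(1,2) by auto
    then have "{h. l < h} \<subset> {h. j < h}" by blast
    then have "card {h. l < h} < card {h. j < h}" by (intro psubset_card_mono) auto
    moreover have "i \<le> l" using less.prems(1) l(1) by (rule order_trans)
    moreover have "x * y \<in> \<R> i l" using mult_R less.prems(1,2) l by blast
    ultimately obtain z where "z \<in> \<R> l m" "x * y * z \<noteq> 0" using less.hyps l(4) by blast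
    then show ?thesis using mult_R[OF l(1) greatest l(3)] by (auto simp: mult.assoc)
  qed
qed

text \<open>The intersection of \<open>N\<close> with the last column is a submodule of
  \<open>N\<close>. Once it is known to be nonzero, simplicity forces it to be all of
  \<open>N\<close>.\<close>

lemma simple_subset_last_column:
  assumes N: "right_submodule \<Lambda> (regular_right_module \<Lambda>) N"
    and simple: "simple_right_module \<Lambda> ((regular_right_module \<Lambda>)\<lparr>carrier := N\<rparr>)"
  shows "N \<subseteq> last_column"
proof -
  have N': "N \<subseteq> carrier \<Lambda>" "(\<lambda>i j. 0) \<in> N" "\<And>X Y. \<lbrakk>X \<in> N; Y \<in> carrier \<Lambda>\<rbrakk> \<Longrightarrow> X \<otimes>\<^bsub>\<Lambda>\<^esub> Y \<in> N"
    using N unfolding regular.right_submodule_iff regular_simps by auto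
  have "N \<noteq> {\<lambda>i j. 0}" using simple by (simp add: simple_right_module_def regular_simps)
  then obtain X where X: "X \<in> N" "X \<noteq> (\<lambda>i j. 0)" using N'(2) by blast
  then obtain i j where ij: "X i j \<noteq> 0" by (metis ext)
  then have ij': "i \<le> j" "X i j \<in> \<R> i j" using X(1) N'(1) by (auto simp: Lambda_def)
  then obtain y where y: "y \<in> \<R> j m" "X i j * y \<noteq> 0" using nonzero_mult_greatest ij by blast
  \<comment> \<open>Column \<open>j\<close> of \<open>X\<close>, multiplied by \<open>y\<close>,
    becomes the last column of \<open>?Y\<close>; its entry in row \<open>i\<close> is
    \<open>X i j * y\<close>, which is nonzero.\<close>
  let ?Y = "X \<otimes>\<^bsub>\<Lambda>\<^esub> matrix_entry j m y"
  have "?Y \<in> N" using N'(3) X(1) y(1) matrix_entry_in greatest by blast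
  moreover have "?Y i m \<noteq> 0" unfolding Lambda_mult_matrix_entry using y(2) by simp
  moreover from \<open>?Y \<in> N\<close> have "?Y \<in> last_column"
    using N'(1) unfolding last_column_def Lambda_mult_matrix_entry by auto
  ultimately have "N \<inter> last_column \<noteq> {\<lambda>i j. 0}" by (metis IntI singletonD)
  moreover have "right_submodule \<Lambda> ((regular_right_module \<Lambda>)\<lparr>carrier := N\<rparr>) (N \<inter> last_column)"
    unfolding right_submodule_restrict_iff[OF regular.right_module_axioms N]
    using N right_submodule_last_column unfolding regular.right_submodule_iff by blast
  ultimately have "N \<inter> last_column = N"
    using simple unfolding simple_right_module_def by (auto simp: regular_simps)
  then show ?thesis by blast
qed

text \<open>The last column is a subgroup containing every simple right ideal. Conversely, a nonzero
  \<open>X\<close> in it satisfies \<open>X = X e\<close>, so it lies in the product of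
  \<open>X\<close> with the corner, which is simple.\<close>

lemma socle_Lambda: "socle \<Lambda> (regular_right_module \<Lambda>) = last_column"
proof
  let ?A = "add_monoid (regular_right_module \<Lambda>)"
  let ?U = "\<Union>{N. right_submodule \<Lambda> (regular_right_module \<Lambda>) N \<and>
      simple_right_module \<Lambda> ((regular_right_module \<Lambda>)\<lparr>carrier := N\<rparr>)}"
  have "?U \<subseteq> last_column"
    by (rule Union_least) (auto dest: simple_subset_last_column)
  moreover have "subgroup last_column ?A"
    using right_submodule_last_column by (simp add: right_submodule_def)
  ultimately show "socle \<Lambda> (regular_right_module \<Lambda>) \<subseteq> last_column"
    unfolding socle_def by (rule regular.M.add.generate_subgroup_incl)
  show "last_column \<subseteq> socle \<Lambda> (regular_right_module \<Lambda>)"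
  proof
    fix X assume X: "X \<in> last_column"
    show "X \<in> socle \<Lambda> (regular_right_module \<Lambda>)"
    \<comment> \<open>The product of the zero matrix with the corner is zero, hence not simple; but
      every generated subgroup contains zero.\<close>
    proof (cases "X = (\<lambda>i j. 0)")
      case True
      then show ?thesis
        unfolding socle_def using generate.one[of ?A ?U] by (simp add: regular_simps)
    next
      case False
      have XL: "X \<in> carrier \<Lambda>" using X by (simp add: last_column_def)
      have "X \<otimes>\<^bsub>\<Lambda>\<^esub> matrix_entry m m (u m) = X" by (rule last_column_unit_right[OF X])
      then have "right_submodule \<Lambda> (regular_right_module \<Lambda>) ((\<lambda>s. X \<otimes>\<^bsub>\<Lambda>\<^esub> s) ` corner)"
        "simple_right_module \<Lambda> ((regular_right_module \<Lambda>)\<lparr>carrier := (\<lambda>s. X \<otimes>\<^bsub>\<Lambda>\<^esub> s) ` corner\<rparr>)"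
        using simple_right_module_ract_image[OF regular.right_module_axioms right_submodule_corner
            corner_unit_in, of X] corner_inverse XL False
        by (simp_all add: regular_simps Lambda_zero)
      moreover have "X \<in> (\<lambda>s. X \<otimes>\<^bsub>\<Lambda>\<^esub> s) ` corner"
        using last_column_unit_right[OF X] corner_unit_in by (metis imageI)
      ultimately have "X \<in> ?U" by (intro UnionI[of "(\<lambda>s. X \<otimes>\<^bsub>\<Lambda>\<^esub> s) ` corner"]) simp_all
      then show ?thesis unfolding socle_def by (rule generate.incl)
    qed
  qed
qed

section \<open>Decomposition of the socle into copies of the corner\<close>

text \<open>The generating set \<open>G\<close> is left open so that the result covers both the
  whole last column and a finite \<open>G\<close>; in the latter case \<open>I\<close>, a subset of
  \<open>G\<close>, is finite as well.\<close>

lemma socle_iso_copies_sum: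
  assumes "G \<subseteq> last_column"
    and "\<And>N. \<lbrakk>right_submodule \<Lambda> (regular_right_module \<Lambda>) N; G \<subseteq> N\<rbrakk> \<Longrightarrow> last_column \<subseteq> N"
  shows "\<exists>I\<subseteq>G. I \<noteq> {} \<and> right_module_iso \<Lambda> (right_socle_module \<Lambda>)
    (copies_sum I ((regular_right_module \<Lambda>)\<lparr>carrier := corner\<rparr>))"
proof -
  let ?V = "(regular_right_module \<Lambda>)\<lparr>carrier := last_column\<rparr>"
  have V: "right_socle_module \<Lambda> = ?V" by (simp add: right_socle_module_def socle_Lambda)
  have "\<exists>I\<subseteq>G. right_module_iso \<Lambda> ?V (copies_sum I ((regular_right_module \<Lambda>)\<lparr>carrier := corner\<rparr>))"
  proof (rule right_module_iso_copies_sum[OF _ right_submodule_corner corner_unit_in])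
    show "right_module \<Lambda> ?V"
      by (rule right_module_restrict[OF regular.right_module_axioms right_submodule_last_column])
    show "\<exists>t\<in>carrier \<Lambda>. s \<otimes>\<^bsub>\<Lambda>\<^esub> t = matrix_entry m m (u m)" if "s \<in> corner" "s \<noteq> \<zero>\<^bsub>\<Lambda>\<^esub>" for s
      using that corner_inverse by (simp add: Lambda_zero)
    show "N = carrier ?V" if "right_submodule \<Lambda> ?V N" "G \<subseteq> N" for N
      using that assms(2)[of N]
      unfolding right_submodule_restrict_iff[OF regular.right_module_axioms right_submodule_last_column]
      by auto
  qed (use assms(1) in \<open>auto simp: regular_simps last_column_unit_right\<close>)
  then obtain I where I: "I \<subseteq> G"
    "right_module_iso \<Lambda> ?V (copies_sum I ((regular_right_module \<Lambda>)\<lparr>carrier := corner\<rparr>))"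
    by blast
  \<comment> \<open>An empty sum of copies has just one element, whereas the last column contains
    both \<open>e\<close> and zero.\<close>
  moreover have "I \<noteq> {}"
  proof
    assume "I = {}"
    then obtain f where f: "inj_on f last_column"
      "f ` last_column = carrier (copies_sum I ((regular_right_module \<Lambda>)\<lparr>carrier := corner\<rparr>))"
      using I(2) unfolding right_module_iso_def bij_betw_def by auto
    have "f X = f Y" if "X \<in> last_column" "Y \<in> last_column" for X Y
    proof -
      have "f X \<in> f ` last_column" "f Y \<in> f ` last_column" using that by auto
      then show ?thesis unfolding f(2) \<open>I = {}\<close> by (simp add: copies_sum_def)
    qed
    moreover have "matrix_entry m m (u m) \<in> last_column" "(\<lambda>i j. 0) \<in> last_column"
      using corner_unit_in by (auto simp: corner_def last_column_def Lambda_carrier_ops)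
    ultimately have "matrix_entry m m (u m) = (\<lambda>i j. 0)" using f(1) by (blast dest: inj_onD)
    then show False using corner_unit_nonzero by simp
  qed
  ultimately show ?thesis unfolding V by blast
qed

text \<open>Finite spanning sets of the spaces \<open>\<R> i m\<close> over \<open>\<R> m m\<close>,
  placed in column \<open>m\<close> of their rows, generate the last column. There are finitely many
  rows, so \<open>G\<close> is finite.\<close>

lemma last_column_finitely_generated:
  assumes "\<forall>i. finite_right_span (\<R> i m) (\<R> m m)"
  shows "\<exists>G\<subseteq>last_column. finite G \<and>
    (\<forall>N. right_submodule \<Lambda> (regular_right_module \<Lambda>) N \<longrightarrow> G \<subseteq> N \<longrightarrow> last_column \<subseteq> N)"
proof -
  obtain B where B: "\<And>i. B i \<subseteq> \<R> i m" "\<And>i. finite (B i)"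
    "\<And>i v. v \<in> \<R> i m \<Longrightarrow> \<exists>c. (\<forall>b\<in>B i. c b \<in> \<R> m m) \<and> v = (\<Sum>b\<in>B i. b * c b)"
    using assms unfolding finite_right_span_def by metis
  define G where "G = (\<Union>i. matrix_entry i m ` B i)"
  have "G \<subseteq> last_column"
    using B(1) greatest by (auto simp: G_def last_column_def intro!: matrix_entry_in)
      (auto simp: matrix_entry_def)
  moreover have "finite G" using B(2) by (auto simp: G_def)
  moreover have "last_column \<subseteq> N"
    if N: "right_submodule \<Lambda> (regular_right_module \<Lambda>) N" "G \<subseteq> N" for N
  proof
    fix X assume X: "X \<in> last_column"
    have N': "(\<lambda>i j. 0) \<in> N" "\<And>X Y. \<lbrakk>X \<in> N; Y \<in> N\<rbrakk> \<Longrightarrow> (\<lambda>i j. X i j + Y i j) \<in> N"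
      "\<And>X Y. \<lbrakk>X \<in> N; Y \<in> carrier \<Lambda>\<rbrakk> \<Longrightarrow> X \<otimes>\<^bsub>\<Lambda>\<^esub> Y \<in> N"
      using N(1) unfolding regular.right_submodule_iff regular_simps by auto
    \<comment> \<open>The index type is kept general: the fact is used for sums over
      \<open>B i\<close> and for the sum over all rows.\<close>
    have sum: "(\<lambda>i j. \<Sum>a\<in>A. F a i j) \<in> N" if "finite A" "\<And>a. a \<in> A \<Longrightarrow> F a \<in> N"
      for A :: "'x set" and F
      using that by (induction A rule: finite_induct) (auto simp: N')
    have entry: "matrix_entry i m (X i m) \<in> N" for i
    proof -
      have "X i m \<in> \<R> i m" using X greatest by (auto simp: last_column_def Lambda_def)
      then obtain c where c: "\<And>b. b \<in> B i \<Longrightarrow> c b \<in> \<R> m m" "X i m = (\<Sum>b\<in>B i. b * c b)"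
        using B(3) by blast
      have "matrix_entry i m (b * c b) \<in> N" if "b \<in> B i" for b
      proof -
        have "matrix_entry i m b \<in> N" using N(2) that by (auto simp: G_def)
        \<comment> \<open>The coefficient \<open>c b\<close> acts as the ring element with
          \<open>c b\<close> in the corner.\<close>
        then have "matrix_entry i m b \<otimes>\<^bsub>\<Lambda>\<^esub> matrix_entry m m (c b) \<in> N"
          using N'(3) matrix_entry_in[OF order_refl c(1)[OF that]] by blast
        also have "matrix_entry i m b \<otimes>\<^bsub>\<Lambda>\<^esub> matrix_entry m m (c b) = matrix_entry i m (b * c b)"
          unfolding Lambda_mult_matrix_entry by (auto simp: matrix_entry_def fun_eq_iff)
        finally show ?thesis .
      qed
      then have "(\<lambda>k l. \<Sum>b\<in>B i. matrix_entry i m (b * c b) k l) \<in> N"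
        using B(2) by (intro sum)
      also have "(\<lambda>k l. \<Sum>b\<in>B i. matrix_entry i m (b * c b) k l) = matrix_entry i m (X i m)"
        unfolding c(2) by (auto simp: matrix_entry_def fun_eq_iff)
      finally show ?thesis .
    qed
    \<comment> \<open>A matrix supported in the last column is the sum of its entries, one for each
      row.\<close>
    have "(\<lambda>k l. \<Sum>i\<in>UNIV. matrix_entry i m (X i m) k l) \<in> N" using entry by (intro sum) auto
    also have "(\<lambda>k l. \<Sum>i\<in>UNIV. matrix_entry i m (X i m) k l) = X"
    proof (intro ext)
      fix k l
      have "(\<Sum>i\<in>UNIV. matrix_entry i m (X i m) k l) = (\<Sum>i\<in>UNIV. if i = k then X k l else 0)"
        by (rule sum.cong) (use X in \<open>auto simp: matrix_entry_def last_column_def\<close>)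
      then show "(\<Sum>i\<in>UNIV. matrix_entry i m (X i m) k l) = X k l" by simp
    qed
    finally show "X \<in> N" .
  qed
  ultimately show ?thesis by blast
qed

end

text \<open>The socle always splits into copies of one simple projective module, but possibly
  infinitely many. Finiteness of their number comes from \<open>finite_right_span\<close>, which is
  why it guards only the second conjunct. The index set consists of matrices because it is a basis
  picked from the last column.\<close>

theorem proposition17:
  fixes scale :: "'k::field \<Rightarrow> 'a::ring \<Rightarrow> 'a"
    and \<R> :: "'p::{finite,order} \<Rightarrow> 'p \<Rightarrow> 'a set"
    and u :: "'p \<Rightarrow> 'a"
    and m :: 'p
  assumes "admissible_system scale \<R> u m"
  shows "(\<exists>(S :: ('p \<Rightarrow> 'p \<Rightarrow> 'a, 'p \<Rightarrow> 'p \<Rightarrow> 'a) right_module) (I :: ('p \<Rightarrow> 'p \<Rightarrow> 'a) set).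
            simple_right_module (Lambda \<R> u) S \<and>
            projective_right_module (Lambda \<R> u) S \<and> I \<noteq> {} \<and>
            right_module_iso (Lambda \<R> u) (right_socle_module (Lambda \<R> u)) (copies_sum I S))
       \<and> ((\<forall>i. finite_right_span (\<R> i m) (\<R> m m)) \<longrightarrow> right_peak (Lambda \<R> u))"
proof (intro conjI impI)
  interpret admissible_system scale \<R> u m by fact
  let ?S = "(regular_right_module \<Lambda>)\<lparr>carrier := corner\<rparr>"
  show "\<exists>S (I :: ('p \<Rightarrow> 'p \<Rightarrow> 'a) set).
      simple_right_module \<Lambda> (S :: ('p \<Rightarrow> 'p \<Rightarrow> 'a, 'p \<Rightarrow> 'p \<Rightarrow> 'a) right_module) \<and>
      projective_right_module \<Lambda> S \<and> I \<noteq> {} \<and>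
      right_module_iso \<Lambda> (right_socle_module \<Lambda>) (copies_sum I S)"
    \<comment> \<open>The last column generates itself, so it may be taken as
      \<open>G\<close>.\<close>
    by (intro exI[of _ ?S]) (use simple_corner projective_corner socle_iso_copies_sum[of last_column] in auto)
  assume "\<forall>i. finite_right_span (\<R> i m) (\<R> m m)"
  then obtain G where "G \<subseteq> last_column" "finite G"
    "\<And>N. \<lbrakk>right_submodule \<Lambda> (regular_right_module \<Lambda>) N; G \<subseteq> N\<rbrakk> \<Longrightarrow> last_column \<subseteq> N"
    using last_column_finitely_generated by meson
  then obtain I where "I \<subseteq> G" "I \<noteq> {}"
    "right_module_iso \<Lambda> (right_socle_module \<Lambda>) (copies_sum I ?S)"
    using socle_iso_copies_sum[of G] by blast
  moreover from this have "finite I" using finite_subset \<open>finite G\<close> by blast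
  ultimately show "right_peak \<Lambda>"
    unfolding right_peak_def
    by (intro conjI ring_Lambda exI[of _ ?S] exI[of _ I] simple_corner projective_corner)
qed

end
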